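(* Let $\epsilon_1,\epsilon_2,\dots$ be independent Rademacher random variables, let $S_n=\epsilon_1+\epsilon_2+\dots+\epsilon_n$, let $\xi\in(0,1]$, and let $P_n=\mathbb{P}\{|S_n|\le \xi\sqrt n\}$. Define $$n_k=2\left\lceil\frac{\frac{k^2}{\xi^2}+k}{2}\right\rceil-k-1,\qquad C_k=\{n: n_k\le n<n_{k+1}\},\qquad Q_k^-=P_{n_{k+1}-1}.$$ Let $\Phi$ be the standard normal distribution function. Then for $k\ge 0$: (a) $P_n=\mathbb{P}\{|S_n|\le \xi\sqrt n\}=\mathbb{P}\{|S_n|\le k\}$ for $n\in C_k$; (b) $Q_k^-=\min_{n\in C_k}P_n$; (c) the sequence $(Q_k^-)$ is strictly monotone increasing in $k$. Moreover: (d) $\lim_{k\to\infty}Q_k^-=2\Phi(\xi)-1$; (e) $Q_1^-=P_{n_2-1}\le P_n$ for all $n\ge n_1$.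
   Context: A Rademacher random variable $\epsilon$ satisfies $\mathbb{P}\{\epsilon=1\}=\mathbb{P}\{\epsilon=-1\}=1/2$. Throughout, $n$ and $k$ denote nonnegative integers (so $C_k$ consists of nonnegative integers), and $S_0=0$.
   Formalization: For ξ = 1 and k = 0 we have n_1 = 0, so C_0 is empty and Q_0^- = P_{-1} is undefined; parts (b) and (c) are therefore stated for all k ≥ 0 when ξ < 1, and only for k ≥ 1 when ξ = 1. *)

theory Defs
  imports "HOL-Probability.Probability"
begin

definition rademacher :: "'a measure \<Rightarrow> ('a \<Rightarrow> real) \<Rightarrow> bool" where
  "rademacher M X \<longleftrightarrow> X \<in> borel_measurable M \<and>
     measure M {\<omega> \<in> space M. X \<omega> = 1} = 1 / 2 \<and>
     measure M {\<omega> \<in> space M. X \<omega> = -1} = 1 / 2"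

definition walk :: "(nat \<Rightarrow> 'a \<Rightarrow> real) \<Rightarrow> nat \<Rightarrow> 'a \<Rightarrow> real" where
  "walk \<epsilon> n \<omega> = (\<Sum>i = 1..n. \<epsilon> i \<omega>)"

definition P_walk :: "'a measure \<Rightarrow> (nat \<Rightarrow> 'a \<Rightarrow> real) \<Rightarrow> real \<Rightarrow> nat \<Rightarrow> real" where
  "P_walk M \<epsilon> \<xi> n = measure M {\<omega> \<in> space M. \<bar>walk \<epsilon> n \<omega>\<bar> \<le> \<xi> * sqrt (real n)}"

text \<open>The thresholds are integers and not natural numbers because the value at \<open>k = 0\<close> is \<open>-1\<close>.\<close>

definition n_thr :: "real \<Rightarrow> nat \<Rightarrow> int" where
  "n_thr \<xi> k = 2 * \<lceil>((real k)\<^sup>2 / \<xi>\<^sup>2 + real k) / 2\<rceil> - int k - 1"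

definition C_set :: "real \<Rightarrow> nat \<Rightarrow> nat set" where
  "C_set \<xi> k = {n. n_thr \<xi> k \<le> int n \<and> int n < n_thr \<xi> (Suc k)}"

text \<open>For \<open>0 < \<xi> \<le> 1\<close> the integer \<open>n_thr \<xi> (Suc k) - 1\<close> is nonnegative, so that \<open>nat\<close> does not
  truncate, except when \<open>\<xi> = 1\<close> and \<open>k = 0\<close>. In that single case it is \<open>-1\<close>, the set \<open>C_set \<xi> k\<close>
  is empty, and the value below has no meaning.\<close>

definition Q_minus :: "'a measure \<Rightarrow> (nat \<Rightarrow> 'a \<Rightarrow> real) \<Rightarrow> real \<Rightarrow> nat \<Rightarrow> real" where
  "Q_minus M \<epsilon> \<xi> k = P_walk M \<epsilon> \<xi> (nat (n_thr \<xi> (Suc k) - 1))"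

end

theory Submission
  imports Defs
begin

text \<open>
  Write \<open>p n i = P(S\<^sub>n = i)\<close> and \<open>A n k = P(\<bar>S\<^sub>n\<bar> \<le> k)\<close>. By parity of \<open>S\<^sub>n\<close>, \<open>P\<^sub>n = A n k\<close> on \<open>C\<^sub>k\<close>, and
  conditioning on the last step gives, for \<open>n + k\<close> odd,
  \<open>A (n + 2) k = A n k - p (n + 1) k * k / (n + 1)\<close>, while \<open>A (n + 1) k \<le> A n k\<close> for
  \<open>n + k\<close> even; so the minimum over \<open>C\<^sub>k\<close> is attained at its last
  element. For the strict monotonicity put \<open>j = k + 1\<close> and let \<open>a\<close>, \<open>b\<close> be the last elements of
  \<open>C\<^sub>k\<close> and \<open>C\<^sub>j\<close> (for \<open>k = 0\<close> simply \<open>A a 0 = 0\<close>). Then \<open>A b j - A a k = p a j - (\<Sum>m. p m j * j / m)\<close>, where \<open>m\<close> runs through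
  \<open>a + 2, a + 4, \<dots>, b - 1\<close>. Since \<open>j\<^sup>2 \<le> a + 2\<close>, \<open>p m j\<close> decreases in \<open>m\<close>, so positivity follows from
  \<open>(\<Sum>m. 1 / m) \<le> ln (b / (a + 1)) / 2 < 1 / j\<close>, i.e. from \<open>b / (a + 1) < exp (2 / j)\<close>. This is elementary
  from \<open>b * j\<^sup>2 < (j + 1)\<^sup>2 * (a + 2)\<close> and parity. The limit is the central limit theorem.
\<close>

subsection \<open>The distribution of the simple random walk\<close>

text \<open>This is \<open>p n i\<close> of the overview, built by conditioning on the last step
  without any probability space; \<open>prob_walk_eq\<close> connects it with the walk.\<close>

fun srw_pmf :: "nat \<Rightarrow> int \<Rightarrow> real" where
  "srw_pmf 0 i = (if i = 0 then 1 else 0)"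
| "srw_pmf (Suc n) i = (srw_pmf n (i - 1) + srw_pmf n (i + 1)) / 2"

lemma srw_pmf_nonneg: "0 \<le> srw_pmf n i"
  by (induction n arbitrary: i) auto

lemma srw_pmf_minus: "srw_pmf n (- i) = srw_pmf n i"
proof (induction n arbitrary: i)
  case (Suc n)
  have "srw_pmf n (- i - 1) = srw_pmf n (i + 1)" "srw_pmf n (- i + 1) = srw_pmf n (i - 1)"
    using Suc[of "i + 1"] Suc[of "i - 1"] by simp_all
  then show ?case by simp
qed simp

lemma srw_pmf_odd: "odd (int n + i) \<Longrightarrow> srw_pmf n i = 0"
  by (induction n arbitrary: i) auto

lemma srw_pmf_pos: "\<bar>i\<bar> \<le> int n \<Longrightarrow> even (int n + i) \<Longrightarrow> 0 < srw_pmf n i"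
proof (induction n arbitrary: i)
  case (Suc n)
  show ?case
  proof (cases "0 < i")
    case True
    with Suc.prems Suc.IH[of "i - 1"] have "0 < srw_pmf n (i - 1)" by auto
    then show ?thesis using srw_pmf_nonneg[of n "i + 1"] by simp
  next
    case False
    \<comment> \<open>For \<open>i = 0\<close> the neighbour used is \<open>1\<close>, which needs
      \<open>1 \<le> n\<close>; parity rules out \<open>n = 0\<close>.\<close>
    have "i + 1 \<le> int n"
    proof (cases "i = 0 \<and> n = 0")
      case True
      then show ?thesis using Suc.prems by simp
    next
      case nz: False
      then show ?thesis using False by linarith
    qed
    then have "\<bar>i + 1\<bar> \<le> int n" using False Suc.prems(1) by linarith
    then have "0 < srw_pmf n (i + 1)" using Suc.prems(2) by (intro Suc.IH) auto
    then show ?thesis using srw_pmf_nonneg[of n "i - 1"] by simp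
  qed
qed simp

text \<open>The binomial identity \<open>(n - u) * C(n, u) = (u + 1) * C(n, u + 1)\<close> with
  \<open>u = (n + i - 1) / 2\<close> up-steps. Free of quotients, it also covers unreachable
  positions and follows from the recursion alone.\<close>

lemma srw_pmf_ratio:
  "(real n + 1 - of_int i) * srw_pmf n (i - 1) = (real n + 1 + of_int i) * srw_pmf n (i + 1)"
proof (induction n arbitrary: i)
  case 0
  then show ?case by auto
next
  case (Suc n)
  have "(real n + 2 - of_int i) * srw_pmf n (i - 2) = (real n + of_int i) * srw_pmf n i"
    "(real n - of_int i) * srw_pmf n i = (real n + 2 + of_int i) * srw_pmf n (i + 2)"
    using Suc[of "i - 1"] Suc[of "i + 1"] by (simp_all add: algebra_simps)
  then show ?case by (simp add: algebra_simps)
qed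

lemma srw_pmf_Suc_left:
  "(real n + 1 + of_int i) * srw_pmf (Suc n) i = (real n + 1) * srw_pmf n (i - 1)"
  using srw_pmf_ratio[of n i] by (simp add: algebra_simps)

lemma srw_pmf_Suc_right:
  "(real n + 1 - of_int i) * srw_pmf (Suc n) i = (real n + 1) * srw_pmf n (i + 1)"
  using srw_pmf_ratio[of n i] by (simp add: algebra_simps)

text \<open>The difference of the two preceding identities. It is the source of the factor
  \<open>k / (n + 1)\<close> in the loss terms of \<open>srw_central_two_steps\<close>.\<close>

lemma srw_pmf_Suc_diff:
  "srw_pmf n (i - 1) - srw_pmf n (i + 1) = 2 * of_int i / (real n + 1) * srw_pmf (Suc n) i"
proof -
  have "(real n + 1) * (srw_pmf n (i - 1) - srw_pmf n (i + 1)) = 2 * of_int i * srw_pmf (Suc n) i"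
    unfolding right_diff_distrib srw_pmf_Suc_left[symmetric] srw_pmf_Suc_right[symmetric]
    by (simp add: algebra_simps del: srw_pmf.simps)
  then show ?thesis by (simp add: field_simps del: srw_pmf.simps)
qed

text \<open>Together the one-step identities give \<open>((n + 2)^2 - i^2) * srw_pmf (n + 2) i = (n
  + 1) * (n + 2) * srw_pmf n i\<close>. The hypothesis makes the left factor at least as large as
  the right one.\<close>

lemma srw_pmf_two_steps_le:
  assumes "i\<^sup>2 \<le> int n + 2"
  shows "srw_pmf (n + 2) i \<le> srw_pmf n i"
proof -
  let ?x = "of_int i :: real" and ?m = "real n"
  have "(of_int (i\<^sup>2)::real) \<le> of_int (int n + 2)"
    using assms by (simp only: of_int_le_iff)
  then have i2: "?x * ?x \<le> ?m + 2" by (simp add: power2_eq_square)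
  have 1: "(?m + 2 + ?x) * srw_pmf (Suc (Suc n)) i = (?m + 2) * srw_pmf (Suc n) (i - 1)"
    using srw_pmf_Suc_left[of "Suc n" i] by (simp add: add.commute add.left_commute del: srw_pmf.simps)
  have 2: "(?m + 2 - ?x) * srw_pmf (Suc n) (i - 1) = (?m + 1) * srw_pmf n i"
    using srw_pmf_Suc_right[of n "i - 1"] by (simp add: algebra_simps del: srw_pmf.simps)
  define D where "D = (?m + 2 + ?x) * (?m + 2 - ?x)"
  have D: "(?m + 1) * (?m + 2) \<le> D"
    using i2 unfolding D_def by (simp add: algebra_simps)
  have "0 < (?m + 1) * (?m + 2)" by simp
  with D have "0 < D" by linarith
  have "D * srw_pmf (n + 2) i = (?m + 2 - ?x) * ((?m + 2 + ?x) * srw_pmf (Suc (Suc n)) i)"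
    unfolding D_def by simp
  also have "\<dots> = (?m + 2) * ((?m + 2 - ?x) * srw_pmf (Suc n) (i - 1))"
    unfolding 1 by simp
  also have "\<dots> = (?m + 1) * (?m + 2) * srw_pmf n i"
    unfolding 2 by simp
  also have "\<dots> \<le> D * srw_pmf n i"
    using D srw_pmf_nonneg by (rule mult_right_mono)
  finally show ?thesis using \<open>0 < D\<close> by simp
qed

section \<open>Probabilities of symmetric intervals\<close>

definition srw_central :: "nat \<Rightarrow> nat \<Rightarrow> real" where
  "srw_central n k = (\<Sum>i\<in>{- int k..int k}. srw_pmf n i)"

lemma sum_symmetric_Suc:
  fixes f :: "int \<Rightarrow> real"
  shows "(\<Sum>i\<in>{- int (Suc k)..int (Suc k)}. f i) =
    (\<Sum>i\<in>{- int k..int k}. f i) + f (int k + 1) + f (- int k - 1)"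
proof -
  have "{- int (Suc k)..int (Suc k)} = insert (int k + 1) (insert (- int k - 1) {- int k..int k})"
    by auto
  then show ?thesis by simp
qed

lemma srw_central_0: "srw_central n 0 = srw_pmf n 0"
  by (simp add: srw_central_def)

lemma srw_central_Suc_right: "srw_central n (Suc k) = srw_central n k + 2 * srw_pmf n (int k + 1)"
  unfolding srw_central_def sum_symmetric_Suc using srw_pmf_minus[of n "int k + 1"] by simp

text \<open>Flux through the boundary: at each of the two ends, half of the mass at distance
  \<open>k + 1\<close> enters and half of the mass at distance \<open>k\<close> leaves.\<close>

lemma srw_central_Suc_left:
  "srw_central (Suc n) k = srw_central n k + srw_pmf n (int k + 1) - srw_pmf n (int k)"
proof (induction k)
  case 0
  show ?case using srw_pmf_minus[of n 1] by (simp add: srw_central_0)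
next
  case (Suc k)
  show ?case unfolding srw_central_Suc_right Suc by (simp add: algebra_simps)
qed

text \<open>By parity, mass only enters in the first step and only leaves in the second. The balance
  is minus half the difference evaluated by \<open>srw_pmf_Suc_diff\<close>.\<close>

lemma srw_central_two_steps:
  assumes "odd (n + k)"
  shows "srw_central (n + 2) k = srw_central n k - srw_pmf (n + 1) (int k) * real k / real (n + 1)"
proof -
  have z: "srw_pmf n (int k) = 0" "srw_pmf (Suc n) (int k + 1) = 0"
    using assms by (auto intro!: srw_pmf_odd simp del: srw_pmf.simps)
  have "srw_central (n + 2) k = srw_central n k + srw_pmf n (int k + 1) - srw_pmf (Suc n) (int k)"
    using z by (simp add: srw_central_Suc_left del: srw_pmf.simps)
  also have "\<dots> = srw_central n k - (srw_pmf n (int k - 1) - srw_pmf n (int k + 1)) / 2"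
    by (simp add: field_simps)
  finally show ?thesis unfolding srw_pmf_Suc_diff by (simp add: field_simps del: srw_pmf.simps)
qed

lemma srw_central_add_even:
  assumes "odd (n + k)"
  shows "srw_central (n + 2 * l) k = srw_central n k -
    (\<Sum>i<l. srw_pmf (n + 1 + 2 * i) (int k) * real k / real (n + 1 + 2 * i))"
proof (induction l)
  case (Suc l)
  have "srw_central (n + 2 * Suc l) k = srw_central (n + 2 * l) k -
      srw_pmf (n + 2 * l + 1) (int k) * real k / real (n + 2 * l + 1)"
    using srw_central_two_steps[of "n + 2 * l" k] assms by (simp add: add.assoc del: srw_pmf.simps)
  then show ?case using Suc by (simp add: ac_simps del: srw_pmf.simps)
qed simp

text \<open>For \<open>odd (n + k)\<close> nonnegative losses are subtracted. For
  \<open>even (n + k)\<close> one preliminary step, which by parity lets no mass in, reduces to that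
  case.\<close>

lemma srw_central_antimono:
  assumes "odd (m + k)" "n \<le> m"
  shows "srw_central m k \<le> srw_central n k"
proof -
  have *: "srw_central m k \<le> srw_central n k" if "odd (n + k)" "n \<le> m" for n
  proof -
    have "even (m - n)" using that assms(1) by presburger
    then obtain l where "m - n = 2 * l" by (elim evenE)
    then have "m = n + 2 * l" using that by simp
    moreover have "0 \<le> (\<Sum>i<l. srw_pmf (n + 1 + 2 * i) (int k) * real k / real (n + 1 + 2 * i))"
      by (intro sum_nonneg divide_nonneg_nonneg mult_nonneg_nonneg srw_pmf_nonneg) auto
    ultimately show ?thesis
      using srw_central_add_even[OF that(1), of l] by simp
  qed
  show ?thesis
  proof (cases "odd (n + k)")
    case True
    then show ?thesis using * assms(2) by blast
  next
    case False
    then have "srw_pmf n (int k + 1) = 0"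
      by (intro srw_pmf_odd) auto
    then have "srw_central (Suc n) k \<le> srw_central n k"
      using srw_pmf_nonneg[of n "int k"] by (simp add: srw_central_Suc_left)
    moreover have "n \<noteq> m" using False assms(1) by auto
    then have "srw_central m k \<le> srw_central (Suc n) k"
      using False assms(2) by (intro *) auto
    ultimately show ?thesis by linarith
  qed
qed

subsection \<open>Comparison of consecutive minima\<close>

text \<open>The omitted terms of the series are positive. The order is four because the cubic
  polynomial would be too small for the last case of \<open>threshold_ratio_less_exp\<close> at
  \<open>j = 2\<close> and \<open>j = 3\<close>.\<close>

lemma exp_gt_Taylor4:
  fixes x :: real
  assumes "0 < x"
  shows "1 + x + x^2 / 2 + x^3 / 6 + x^4 / 24 < exp x"
proof -
  have s: "summable (\<lambda>n. x^n /\<^sub>R fact n)" by (rule summable_exp_generic)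
  have "(\<Sum>n<5. x^n /\<^sub>R fact n) < (\<Sum>n. x^n /\<^sub>R fact n)"
    using assms by (intro sum_less_suminf s) simp
  then show ?thesis
    by (simp add: exp_def eval_nat_numeral field_simps fact_numeral)
qed

lemma even_add_less_imp: "(m::nat) < n \<Longrightarrow> even (m + n) \<Longrightarrow> m + 2 \<le> n"
  by presburger

lemma frac_le_cross:
  fixes a b c d :: real
  assumes "d * a \<le> c * b" "0 < b" "0 < d"
  shows "a / b \<le> c / d"
  using assms by (simp add: pos_divide_le_eq pos_le_divide_eq mult.commute)

text \<open>Write \<open>a + 2 = j\<^sup>2 + 2 * i\<close>. For \<open>2 * i < j\<close> the upper bound on \<open>b\<close> has to be sharpened by
  parity; for \<open>j \<le> 2 * i\<close> it suffices as it stands.\<close>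

lemma threshold_ratio_less_exp:
  fixes j a b :: nat
  assumes j: "2 \<le> j" and a: "j\<^sup>2 \<le> a + 2" and par: "even (a + j)" "odd (a + b)"
    and b: "b * j\<^sup>2 < (j + 1)\<^sup>2 * (a + 2)"
  shows "real b / (real a + 1) < exp (2 / real j)"
proof -
  let ?x = "2 / real j" and ?j = "real j"
  have exp: "1 + 2 / ?j + 2 / ?j^2 + 4 / (3 * ?j^3) + 2 / (3 * ?j^4) < exp ?x"
    using exp_gt_Taylor4[of ?x] j by (simp add: power_divide)
  then have exp2: "1 + 2 / ?j + 2 / ?j^2 < exp ?x"
    using j by (smt (verit) divide_nonneg_nonneg of_nat_0_le_iff zero_le_power mult_nonneg_nonneg)
  have "even (j\<^sup>2 + a)" using par by simp
  then obtain i where i: "a + 2 = j\<^sup>2 + 2 * i"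
    using a by (metis dvd_def even_add even_numeral le_iff_add)
  consider "i = 0" | "1 \<le> i" "2 * i < j" | "j \<le> 2 * i" by linarith
  then show ?thesis
  proof cases
    case 1
    then have "b * j\<^sup>2 < (j + 1)\<^sup>2 * j\<^sup>2" using b unfolding i by simp
    then have "b < (j + 1)\<^sup>2" by (metis mult_less_cancel2)
    \<comment> \<open>Both summands have the parity of \<open>j + 1\<close>, so the strict bound on
      \<open>b\<close> improves by one.\<close>
    moreover have "even (b + (j + 1)\<^sup>2)" using par by auto
    ultimately have "b + 2 \<le> (j + 1)\<^sup>2"
      by (rule even_add_less_imp)
    then have "real (b + 2) \<le> real ((j + 1)\<^sup>2)" by (simp only: of_nat_le_iff)
    then have bj: "real b \<le> ?j^2 + 2 * ?j - 1" by (simp add: power2_eq_square algebra_simps)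
    have "real (a + 2) = real (j\<^sup>2)" using i 1 by simp
    then have aj: "real a + 1 = ?j^2 - 1" by simp
    have j4: "2 * ?j \<le> ?j^2" using j by (simp add: power2_eq_square)
    have pos: "0 < ?j^2 - 1" using j4 j by linarith
    have "real b / (real a + 1) \<le> (?j^2 + 2 * ?j - 1) / (?j^2 - 1)"
      unfolding aj using bj pos by (intro divide_right_mono) auto
    also have "\<dots> \<le> 1 + 2 / ?j + 2 / ?j^2"
    proof -
      have "?j^2 * (?j^2 + 2 * ?j - 1) \<le> (?j^2 + 2 * ?j + 2) * (?j^2 - 1)"
      proof -
        have "(?j^2 + 2 * ?j + 2) * (?j^2 - 1) = ?j^2 * (?j^2 + 2 * ?j - 1) + (2 * ?j^2 - 2 * ?j - 2)"
          by (simp add: power2_eq_square algebra_simps)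
        moreover have "2 \<le> ?j" using j by simp
        ultimately show ?thesis using j4 by linarith
      qed
      moreover have "1 + 2 / ?j + 2 / ?j^2 = (?j^2 + 2 * ?j + 2) / ?j^2"
        using j by (simp add: power2_eq_square field_simps)
      moreover have "0 < ?j^2" using j by simp
      ultimately show ?thesis using pos frac_le_cross by metis
    qed
    finally show ?thesis using exp2 by linarith
  next
    case 2
    \<comment> \<open>This makes the last term of \<open>(j + 1)^2 * (a + 2) / j^2 = (j + 1)^2 + 2 *
      i + 2 * i * (2 * j + 1) / j^2\<close> less than 2, and parity then removes it from the bound
      on \<open>b\<close>.\<close>
    have "i * (2 * j + 1) < j\<^sup>2"
    proof -
      have "2 * i * (2 * j + 1) \<le> (j - 1) * (2 * j + 1)" using 2 by (intro mult_right_mono) auto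
      also have "\<dots> < 2 * j\<^sup>2"
        using j by (cases j) (auto simp: power2_eq_square algebra_simps)
      finally show ?thesis by simp
    qed
    moreover have "(j + 1)\<^sup>2 * (a + 2) = j\<^sup>2 * ((j + 1)\<^sup>2 + 2 * i) + 2 * (i * (2 * j + 1))"
      unfolding i by (simp add: power2_eq_square algebra_simps)
    ultimately have "b * j\<^sup>2 < ((j + 1)\<^sup>2 + 2 * i + 2) * j\<^sup>2"
      using b by (simp add: algebra_simps)
    then have "b < (j + 1)\<^sup>2 + 2 * i + 2" by (metis mult_less_cancel2)
    moreover have "even (b + ((j + 1)\<^sup>2 + 2 * i + 2))" using par by auto
    ultimately have "b + 2 \<le> (j + 1)\<^sup>2 + 2 * i + 2" by (rule even_add_less_imp)
    then have "b \<le> (j + 1)\<^sup>2 + 2 * i" by simp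
    then have "real b \<le> real ((j + 1)\<^sup>2 + 2 * i)" by (simp only: of_nat_le_iff)
    then have bj: "real b \<le> (?j^2 + 2 * real i - 1) + (2 * ?j + 2)"
      by (simp add: power2_eq_square algebra_simps)
    have "real (a + 2) = real (j\<^sup>2 + 2 * i)" using i by simp
    then have aj: "real a + 1 = ?j^2 + 2 * real i - 1" by simp
    \<comment> \<open>Thanks to \<open>1 \<le> i\<close> the denominator \<open>a + 1\<close> is at
      least \<open>j^2\<close>; for \<open>i = 0\<close> it falls short by one.\<close>
    have ge: "?j^2 \<le> ?j^2 + 2 * real i - 1" using 2 by simp
    have pos: "0 < ?j^2" using j by simp
    have "real b / (real a + 1) \<le> ((?j^2 + 2 * real i - 1) + (2 * ?j + 2)) / (?j^2 + 2 * real i - 1)"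
      unfolding aj by (intro divide_right_mono bj) (use ge pos in linarith)
    also have "\<dots> = 1 + (2 * ?j + 2) / (?j^2 + 2 * real i - 1)"
      unfolding add_divide_distrib by (subst divide_self) (use ge pos in linarith, simp)
    also have "\<dots> \<le> 1 + (2 * ?j + 2) / ?j^2"
      by (intro add_left_mono divide_left_mono mult_pos_pos) (use ge pos j in linarith)+
    also have "\<dots> = 1 + 2 / ?j + 2 / ?j^2"
      using j by (simp add: power2_eq_square field_simps)
    finally show ?thesis using exp2 by linarith
  next
    case 3
    have "real (b * j\<^sup>2) < real ((j + 1)\<^sup>2 * (a + 2))" using b by (simp only: of_nat_less_iff)
    then have b': "real b * ?j^2 < (?j + 1)^2 * (real a + 2)" by (simp add: algebra_simps)
    have "real (a + 2) = real (j\<^sup>2 + 2 * i)" using i by simp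
    moreover have "?j \<le> 2 * real i" using 3 by linarith
    ultimately have aj: "?j^2 + ?j - 1 \<le> real a + 1" by simp
    have j4: "2 * ?j \<le> ?j^2" using j by (simp add: power2_eq_square)
    have pos: "0 < ?j^2 + ?j - 1" using j4 j by linarith
    \<comment> \<open>This bound decreases in \<open>a\<close>, so it is estimated at the lower end
      \<open>a + 2 = j^2 + j\<close>.\<close>
    have "real b / (real a + 1) < (?j + 1)^2 / ?j^2 * ((real a + 2) / (real a + 1))"
    proof -
      have "0 < ?j^2" using j by simp
      then have "real b < (?j + 1)^2 * (real a + 2) / ?j^2" using b' by (simp only: pos_less_divide_eq)
      then have "real b / (real a + 1) < (?j + 1)^2 * (real a + 2) / ?j^2 / (real a + 1)"
        by (intro divide_strict_right_mono) auto
      then show ?thesis by (simp add: mult_ac)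
    qed
    also have "(real a + 2) / (real a + 1) \<le> (?j^2 + ?j) / (?j^2 + ?j - 1)"
    proof (rule frac_le_cross)
      have "(?j^2 + ?j) * (real a + 1) - (?j^2 + ?j - 1) * (real a + 2) = real a + 1 - (?j^2 + ?j - 1)"
        by (simp add: algebra_simps)
      then show "(?j^2 + ?j - 1) * (real a + 2) \<le> (?j^2 + ?j) * (real a + 1)" using aj by linarith
    qed (use pos in auto)
    then have "(?j + 1)^2 / ?j^2 * ((real a + 2) / (real a + 1))
      \<le> (?j + 1)^2 / ?j^2 * ((?j^2 + ?j) / (?j^2 + ?j - 1))"
      by (intro mult_left_mono) auto
    also have "\<dots> = (?j + 1)^3 / (?j * (?j^2 + ?j - 1))"
    proof -
      have "?j^2 + ?j = ?j * (?j + 1)" by (simp add: power2_eq_square algebra_simps)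
      then show ?thesis using j pos by (simp add: power2_eq_square power3_eq_cube)
    qed
    also have "\<dots> \<le> 1 + 2 / ?j + 2 / ?j^2 + 4 / (3 * ?j^3) + 2 / (3 * ?j^4)"
    proof -
      have j3: "2 * ?j + 2 \<le> ?j^3"
      proof -
        have "?j * (2 * ?j) \<le> ?j * ?j^2" using j4 by (intro mult_left_mono) auto
        also have "?j * ?j^2 = ?j^3" by (simp add: power2_eq_square power3_eq_cube)
        finally have "2 * ?j^2 \<le> ?j^3" by (simp add: power2_eq_square)
        then show ?thesis using j4 j by linarith
      qed
      have "3 * ?j^4 * (?j + 1)^3 \<le> (3 * ?j^4 + 6 * ?j^3 + 6 * ?j^2 + 4 * ?j + 2) * (?j * (?j^2 + ?j - 1))"
      proof -
        \<comment> \<open>All powers above the fourth cancel, and the remainder is nonnegative from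
          \<open>j = 2\<close> on.\<close>
        have "(3 * ?j^4 + 6 * ?j^3 + 6 * ?j^2 + 4 * ?j + 2) * (?j * (?j^2 + ?j - 1))
          - 3 * ?j^4 * (?j + 1)^3 = ?j * (?j^3 - (2 * ?j + 2))"
          by (simp add: power2_eq_square power3_eq_cube power4_eq_xxxx algebra_simps)
        also have "0 \<le> \<dots>" using j3 by simp
        finally show ?thesis by simp
      qed
      moreover have "0 < ?j * (?j^2 + ?j - 1)" using pos j by simp
      moreover have "0 < 3 * ?j^4" using j by simp
      ultimately have "(?j + 1)^3 / (?j * (?j^2 + ?j - 1))
        \<le> (3 * ?j^4 + 6 * ?j^3 + 6 * ?j^2 + 4 * ?j + 2) / (3 * ?j^4)"
        by (rule frac_le_cross)
      also have "\<dots> = 1 + 2 / ?j + 2 / ?j^2 + 4 / (3 * ?j^3) + 2 / (3 * ?j^4)"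
        using j by (simp add: add_divide_distrib power2_eq_square power3_eq_cube power4_eq_xxxx)
      finally show ?thesis .
    qed
    also note exp
    finally show ?thesis .
  qed
qed

text \<open>Midpoint rule for the convex function \<open>1 / t\<close>: \<open>2 / (y + 1)\<close>
  is at most its integral over \<open>[y, y + 2]\<close>, and the logarithms telescope.\<close>

lemma sum_inverse_odd_steps_le_ln:
  fixes x :: real
  assumes "0 < x"
  shows "(\<Sum>i<l. 2 / (x + 1 + 2 * real i)) \<le> ln ((x + 2 * real l) / x)"
proof (induction l)
  case 0
  then show ?case using assms by simp
next
  case (Suc l)
  let ?y = "x + 2 * real l"
  have y: "0 < ?y" using assms by (simp add: add_pos_nonneg)
  have "2 * (?y + 2 - ?y) / (?y + (?y + 2)) \<le> ln (?y + 2) - ln ?y"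
    using y by (intro ln_inverse_approx_ge) auto
  also have "2 * (?y + 2 - ?y) / (?y + (?y + 2)) = 2 / (x + 1 + 2 * real l)"
    using y by (simp add: field_simps)
  finally have "2 / (x + 1 + 2 * real l) \<le> ln (?y + 2) - ln ?y" .
  then show ?case using Suc assms y by (simp add: ln_div algebra_simps)
qed

text \<open>Here \<open>\<xi>\<close> is eliminated: besides parity and order, only
  \<open>j^2 \<le> a + 2\<close> and \<open>b / (a + 2) < (j + 1)^2 / j^2\<close> with
  \<open>j = k + 1\<close> are kept. The gain \<open>srw_pmf a j\<close> exceeds the sum of all
  later losses.\<close>

lemma srw_central_step_less:
  fixes k a b :: nat
  assumes k: "1 \<le> k" and a: "(k + 1)\<^sup>2 \<le> a + 2" and par: "odd (a + k)" "odd (a + b)"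
    and ab: "a < b" and b: "b * (k + 1)\<^sup>2 < (k + 2)\<^sup>2 * (a + 2)"
  shows "srw_central a k < srw_central b (k + 1)"
proof -
  define j where "j = k + 1"
  have "even (b - (a + 1))" using ab par(2) by presburger
  then obtain l where "b - (a + 1) = 2 * l" by (elim evenE)
  then have l: "b = a + 1 + 2 * l" using ab by simp
  have "k + 1 \<le> a"
  proof -
    have "2 * (k + 1) \<le> (k + 1)\<^sup>2" unfolding power2_eq_square using k by (intro mult_right_mono) auto
    then have "2 * (k + 1) \<le> a + 2" using a by (rule le_trans)
    then show ?thesis using k by presburger
  qed
  then have pos: "0 < srw_pmf a (int j)"
    using par unfolding j_def by (intro srw_pmf_pos) auto
  have decr: "srw_pmf (a + 2 * i) (int j) \<le> srw_pmf a (int j)" for i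
  proof (induction i)
    case (Suc i)
    have "(int j)\<^sup>2 \<le> int (a + 2 * i) + 2"
    proof -
      have "int ((k + 1)\<^sup>2) \<le> int (a + 2)" using a by (simp only: of_nat_le_iff)
      then show ?thesis by (simp add: j_def)
    qed
    from srw_pmf_two_steps_le[OF this] show ?case using Suc by (simp del: srw_pmf.simps)
  qed simp
  \<comment> \<open>The loss at time \<open>m = a + 2 + 2 * i\<close>, with the mass at
    \<open>j\<close> replaced by its larger value at time \<open>a\<close>; the factor 2 is split
    off to match the logarithmic bound.\<close>
  have le: "srw_pmf (a + 1 + 1 + 2 * i) (int j) * real j / real (a + 1 + 1 + 2 * i)
      \<le> (srw_pmf a (int j) * real j / 2) * (2 / (real (a + 1) + 1 + 2 * real i))" for i
  proof -
    have D: "real (a + 1) + 1 + 2 * real i = real (a + 1 + 1 + 2 * i)" by simp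
    have "srw_pmf (a + 1 + 1 + 2 * i) (int j) \<le> srw_pmf a (int j)"
      using decr[of "Suc i"] by (simp del: srw_pmf.simps)
    then have "srw_pmf (a + 1 + 1 + 2 * i) (int j) * real j / D \<le> srw_pmf a (int j) * real j / D"
      if "0 \<le> D" for D
      using that by (intro divide_right_mono mult_right_mono) auto
    from this[OF of_nat_0_le_iff, of "a + 1 + 1 + 2 * i"] show ?thesis
      unfolding D by (simp del: srw_pmf.simps)
  qed
  have sum: "(\<Sum>i<l. 2 / (real (a + 1) + 1 + 2 * real i)) < 2 / real j"
  proof -
    have "(\<Sum>i<l. 2 / (real (a + 1) + 1 + 2 * real i)) \<le> ln ((real (a + 1) + 2 * real l) / real (a + 1))"
      by (rule sum_inverse_odd_steps_le_ln) simp
    also have "\<dots> = ln (real b / (real a + 1))" unfolding l by (simp add: add.commute)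
    also have "\<dots> < ln (exp (2 / real j))"
    proof (subst ln_less_cancel_iff)
      show "real b / (real a + 1) < exp (2 / real j)"
        using assms unfolding j_def by (intro threshold_ratio_less_exp) (auto simp: add.assoc)
    qed (use ab in auto)
    finally show ?thesis by simp
  qed
  have "(\<Sum>i<l. srw_pmf (a + 1 + 1 + 2 * i) (int j) * real j / real (a + 1 + 1 + 2 * i))
    \<le> (srw_pmf a (int j) * real j / 2) * (\<Sum>i<l. 2 / (real (a + 1) + 1 + 2 * real i))"
    unfolding sum_distrib_left by (rule sum_mono) (rule le)
  also have "\<dots> < (srw_pmf a (int j) * real j / 2) * (2 / real j)"
    using sum pos by (intro mult_strict_left_mono) (auto simp: j_def)
  also have "\<dots> = srw_pmf a (int j)" by (simp add: j_def)
  finally have less: "(\<Sum>i<l. srw_pmf (a + 1 + 1 + 2 * i) (int j) * real j / real (a + 1 + 1 + 2 * i))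
    < srw_pmf a (int j)" .
  \<comment> \<open>Widening gains \<open>2 * srw_pmf a j\<close>; the step to \<open>a + 1\<close>
    loses half of it and lets nothing in. From \<open>a + 1\<close> on, the parity fits
    \<open>srw_central_add_even\<close>.\<close>
  have "srw_pmf a (int j + 1) = 0" using par by (intro srw_pmf_odd) (auto simp: j_def)
  then have "srw_central (a + 1) j = srw_central a k + srw_pmf a (int j)"
    by (simp add: srw_central_Suc_left srw_central_Suc_right j_def add.commute)
  moreover have "srw_central b j = srw_central (a + 1) j -
      (\<Sum>i<l. srw_pmf (a + 1 + 1 + 2 * i) (int j) * real j / real (a + 1 + 1 + 2 * i))"
    unfolding l using par by (intro srw_central_add_even) (auto simp: j_def)
  ultimately show ?thesis using less unfolding j_def by linarith
qed

subsection \<open>The thresholds\<close>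

text \<open>With \<open>n_thr_upper\<close> and \<open>even_n_thr\<close> this says that
  \<open>n_thr \<xi> k + 1\<close> is the least integer of the parity of \<open>k\<close> that is at
  least \<open>k^2 / \<xi>^2\<close>.\<close>

lemma n_thr_lower: "(real k)\<^sup>2 / \<xi>\<^sup>2 \<le> of_int (n_thr \<xi> k) + 1"
proof -
  define x where "x = (real k)\<^sup>2 / \<xi>\<^sup>2 + real k"
  have "x \<le> 2 * of_int \<lceil>x / 2\<rceil>" by linarith
  then show ?thesis by (simp add: n_thr_def x_def)
qed

lemma n_thr_upper: "of_int (n_thr \<xi> k) - 1 < (real k)\<^sup>2 / \<xi>\<^sup>2"
proof -
  define x where "x = (real k)\<^sup>2 / \<xi>\<^sup>2 + real k"
  have "2 * of_int \<lceil>x / 2\<rceil> < x + 2" by linarith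
  then show ?thesis by (simp add: n_thr_def x_def)
qed

lemma even_n_thr: "even (n_thr \<xi> k) \<longleftrightarrow> odd k"
  unfolding n_thr_def by simp

lemma n_thr_0: "n_thr \<xi> 0 = -1"
  by (simp add: n_thr_def)

section \<open>The blocks \<open>C_set \<xi> k\<close> and their last elements\<close>

context
  fixes \<xi> :: real
  assumes \<xi>: "0 < \<xi>" "\<xi> \<le> 1"
begin

text \<open>Division by \<open>\<xi>^2 \<le> 1\<close> stretches distances; the bound
  \<open>\<xi> \<le> 1\<close> enters through this lemma.\<close>

lemma square_diff_div_ge:
  fixes x y :: real
  assumes "y \<le> x"
  shows "x - y \<le> x / \<xi>\<^sup>2 - y / \<xi>\<^sup>2"
proof -
  have "\<xi>\<^sup>2 \<le> 1" using \<xi> by (simp add: power_le_one)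
  then have "(x - y) * \<xi>\<^sup>2 \<le> (x - y) * 1" using assms by (intro mult_left_mono) auto
  then have "x - y \<le> (x - y) / \<xi>\<^sup>2" using \<xi> by (simp add: pos_le_divide_eq)
  then show ?thesis by (simp add: diff_divide_distrib)
qed

text \<open>Consecutive squares differ by at least one, so the two threshold bounds give
  \<open>\<le>\<close>; opposite parities exclude equality.\<close>

lemma n_thr_less_Suc: "n_thr \<xi> k < n_thr \<xi> (Suc k)"
proof -
  have "(real (Suc k))\<^sup>2 - (real k)\<^sup>2 \<le> (real (Suc k))\<^sup>2 / \<xi>\<^sup>2 - (real k)\<^sup>2 / \<xi>\<^sup>2"
    by (rule square_diff_div_ge) simp
  then have "real_of_int (n_thr \<xi> k) < of_int (n_thr \<xi> (Suc k)) + 1"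
    using n_thr_upper[of \<xi> k] n_thr_lower[of "Suc k" \<xi>] by (simp add: power2_eq_square algebra_simps)
  then have "n_thr \<xi> k \<le> n_thr \<xi> (Suc k)" by linarith
  moreover have "n_thr \<xi> k \<noteq> n_thr \<xi> (Suc k)"
    using even_n_thr[of \<xi> k] even_n_thr[of \<xi> "Suc k"] by auto
  ultimately show ?thesis by simp
qed

lemma strict_mono_n_thr: "strict_mono (n_thr \<xi>)"
  using n_thr_less_Suc by (simp add: strict_mono_Suc_iff)

lemma n_thr_ge: "int k \<le> n_thr \<xi> k + 1"
proof (induction k)
  case (Suc k)
  then show ?case using n_thr_less_Suc[of k] by simp
qed (simp add: n_thr_0)

lemma n_thr_1_pos:
  assumes "\<xi> < 1"
  shows "2 \<le> n_thr \<xi> 1"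
proof -
  have "\<xi>\<^sup>2 < 1" using \<xi> assms by (simp add: power_less_one_iff)
  then have "1 < 1 / \<xi>\<^sup>2" using \<xi> by (simp add: pos_less_divide_eq)
  then have "0 < n_thr \<xi> 1" using n_thr_lower[of 1 \<xi>] by simp
  moreover have "even (n_thr \<xi> 1)" by (simp add: even_n_thr)
  ultimately show ?thesis by presburger
qed

text \<open>The assumption amounts to nonemptiness of the block: for \<open>\<xi> = 1\<close> and
  \<open>k = 0\<close> it would contain only \<open>-1\<close>. The parity of the last element is
  the one that \<open>srw_central_antimono\<close> asks for.\<close>

lemma C_set_last:
  assumes "\<xi> < 1 \<or> 1 \<le> k"
  shows "int (nat (n_thr \<xi> (Suc k) - 1)) = n_thr \<xi> (Suc k) - 1"
    and "nat (n_thr \<xi> (Suc k) - 1) \<in> C_set \<xi> k"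
    and "odd (nat (n_thr \<xi> (Suc k) - 1) + k)"
proof -
  have "1 \<le> n_thr \<xi> (Suc k)"
  proof (cases k)
    case 0
    then show ?thesis using assms n_thr_1_pos by simp
  next
    case (Suc k')
    then show ?thesis using n_thr_ge[of "Suc k"] by simp
  qed
  then show *: "int (nat (n_thr \<xi> (Suc k) - 1)) = n_thr \<xi> (Suc k) - 1" by simp
  then show "nat (n_thr \<xi> (Suc k) - 1) \<in> C_set \<xi> k"
    using n_thr_less_Suc[of k] by (simp add: C_set_def)
  have "even (n_thr \<xi> (Suc k)) \<longleftrightarrow> even k" by (simp add: even_n_thr)
  then have "odd (int (nat (n_thr \<xi> (Suc k) - 1)) + int k)"
    unfolding * by auto
  then show "odd (nat (n_thr \<xi> (Suc k) - 1) + k)" by (metis even_of_nat of_nat_add)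
qed

lemma finite_C_set: "finite (C_set \<xi> k)"
proof (rule finite_subset)
  show "C_set \<xi> k \<subseteq> {..<nat (n_thr \<xi> (Suc k))}" unfolding C_set_def by auto
qed simp

text \<open>The blocks tile the integers from \<open>n_thr \<xi> 0 = -1\<close> on, so the first
  threshold beyond \<open>n\<close> determines its block.\<close>

lemma C_set_cover:
  assumes "n_thr \<xi> m \<le> int n"
  obtains k where "m \<le> k" "n \<in> C_set \<xi> k"
proof -
  define k where "k = (LEAST k. int n < n_thr \<xi> (Suc k))"
  have ex: "int n < n_thr \<xi> (Suc (n + 1))" using n_thr_ge[of "Suc (n + 1)"] by simp
  then have k: "int n < n_thr \<xi> (Suc k)" unfolding k_def by (rule LeastI)
  have "n_thr \<xi> m < n_thr \<xi> (Suc k)" using assms k by simp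
  then have mk: "m \<le> k" using strict_mono_less[OF strict_mono_n_thr] by simp
  have "n_thr \<xi> k \<le> int n"
  proof (cases k)
    case 0
    then show ?thesis by (simp add: n_thr_0)
  next
    case (Suc k')
    then have "k' < k" by simp
    then have "\<not> int n < n_thr \<xi> (Suc k')" unfolding k_def by (rule not_less_Least)
    then show ?thesis using Suc by simp
  qed
  with k mk show ?thesis by (intro that[of k]) (auto simp: C_set_def)
qed

text \<open>The left side means \<open>s^2 / \<xi>^2 \<le> n\<close>. Below the next threshold this
  excludes \<open>\<bar>s\<bar> \<ge> k + 1\<close>; from \<open>n_thr \<xi> k + 1\<close> on it
  holds for all \<open>\<bar>s\<bar> \<le> k\<close>.\<close>

lemma abs_le_iff_C_set:
  assumes "n \<in> C_set \<xi> k" "even (int n + s)"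
  shows "\<bar>of_int s\<bar> \<le> \<xi> * sqrt (real n) \<longleftrightarrow> \<bar>of_int s\<bar> \<le> real k"
proof -
  let ?s = "\<bar>of_int s\<bar> :: real"
  have "?s \<le> \<xi> * sqrt (real n) \<longleftrightarrow> ?s / \<xi> \<le> sqrt (real n)"
    using \<xi> by (simp add: pos_divide_le_eq mult.commute)
  also have "\<dots> \<longleftrightarrow> (?s / \<xi>)\<^sup>2 \<le> real n"
    using \<xi> by (smt (verit) divide_nonneg_pos real_le_rsqrt real_sqrt_le_iff real_sqrt_unique real_sqrt_abs)
  also have "\<dots> \<longleftrightarrow> ?s\<^sup>2 / \<xi>\<^sup>2 \<le> real n" by (simp add: power_divide)
  also have "\<dots> \<longleftrightarrow> ?s \<le> real k"
  proof
    assume le: "?s\<^sup>2 / \<xi>\<^sup>2 \<le> real n"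
    have "int n \<le> n_thr \<xi> (Suc k) - 1" using assms(1) by (simp add: C_set_def)
    then have "real_of_int (int n) \<le> of_int (n_thr \<xi> (Suc k) - 1)" by (simp only: of_int_le_iff)
    with le n_thr_upper[of \<xi> "Suc k"] have "?s\<^sup>2 / \<xi>\<^sup>2 < (real (Suc k))\<^sup>2 / \<xi>\<^sup>2" by simp
    then have "?s\<^sup>2 < (real (Suc k))\<^sup>2" using \<xi> by (simp add: divide_less_cancel)
    then have "?s < real (Suc k)" by (rule power2_less_imp_less) simp
    then have "\<bar>s\<bar> < int (Suc k)" by linarith
    then show "?s \<le> real k" by linarith
  next
    assume le: "?s \<le> real k"
    have nk: "n_thr \<xi> k \<le> int n" using assms(1) by (simp add: C_set_def)
    show "?s\<^sup>2 / \<xi>\<^sup>2 \<le> real n"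
    proof (cases "n_thr \<xi> k = int n")
      case False
      then have "n_thr \<xi> k + 1 \<le> int n" using nk by simp
      then have "real_of_int (n_thr \<xi> k + 1) \<le> of_int (int n)" by (simp only: of_int_le_iff)
      moreover have "?s\<^sup>2 / \<xi>\<^sup>2 \<le> (real k)\<^sup>2 / \<xi>\<^sup>2"
        using le by (intro divide_right_mono power_mono) auto
      ultimately show ?thesis using n_thr_lower[of k \<xi>] by simp
    next
      \<comment> \<open>At the threshold itself \<open>k^2 / \<xi>^2\<close> may exceed
        \<open>n\<close> by up to one. Parity excludes \<open>\<bar>s\<bar> = k\<close>, and passing
        to \<open>k - 1\<close> lowers the quotient by at least one.\<close>
      case True
      have "even (int n) \<longleftrightarrow> odd k" using even_n_thr[of \<xi> k] unfolding True .
      then have "odd (\<bar>s\<bar> + int k)" using assms(2) by auto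
      then have "\<bar>s\<bar> \<noteq> int k" by (metis even_add)
      moreover have "\<bar>s\<bar> \<le> int k" using le by linarith
      ultimately have sk: "\<bar>s\<bar> \<le> int k - 1" by linarith
      then have sk': "?s \<le> real k - 1" by linarith
      have "(real k - 1)\<^sup>2 \<le> (real k)\<^sup>2" using sk by (intro power_mono) auto
      then have "(real k)\<^sup>2 - (real k - 1)\<^sup>2 \<le> (real k)\<^sup>2 / \<xi>\<^sup>2 - (real k - 1)\<^sup>2 / \<xi>\<^sup>2"
        by (rule square_diff_div_ge)
      moreover have "1 \<le> real k" using sk by linarith
      ultimately have "(real k - 1)\<^sup>2 / \<xi>\<^sup>2 \<le> (real k)\<^sup>2 / \<xi>\<^sup>2 - 1"
        by (simp add: power2_eq_square algebra_simps)
      moreover have "?s\<^sup>2 / \<xi>\<^sup>2 \<le> (real k - 1)\<^sup>2 / \<xi>\<^sup>2"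
        using sk' by (intro divide_right_mono power_mono) auto
      ultimately show ?thesis using n_thr_lower[of k \<xi>] True by simp
    qed
  qed
  finally show ?thesis .
qed

lemma srw_central_last_less:
  assumes "\<xi> < 1 \<or> 1 \<le> k"
  shows "srw_central (nat (n_thr \<xi> (Suc k) - 1)) k <
    srw_central (nat (n_thr \<xi> (Suc (Suc k)) - 1)) (Suc k)"
proof -
  define a where "a = nat (n_thr \<xi> (Suc k) - 1)"
  define b where "b = nat (n_thr \<xi> (Suc (Suc k)) - 1)"
  have a: "int a = n_thr \<xi> (Suc k) - 1" "odd (a + k)"
    unfolding a_def using assms by (rule C_set_last)+
  have b: "int b = n_thr \<xi> (Suc (Suc k)) - 1" "odd (b + Suc k)"
    unfolding b_def by (rule C_set_last; simp)+
  have ab: "a < b" using a(1) b(1) n_thr_less_Suc[of "Suc k"] by simp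
  show ?thesis
  proof (cases "k = 0")
    case True
    have "srw_central a 0 = 0" using a(2) True by (simp add: srw_central_0 srw_pmf_odd)
    moreover have "0 < srw_pmf b 0" using b(2) True by (intro srw_pmf_pos) auto
    then have "0 < srw_central b 1"
      using srw_central_Suc_right[of b 0] srw_pmf_nonneg[of b 1] by (simp add: srw_central_0)
    ultimately show ?thesis using True unfolding a_def[symmetric] b_def[symmetric] by simp
  next
    case False
    have ra: "real a + 2 = of_int (n_thr \<xi> (Suc k)) + 1" using a(1) by linarith
    have rb: "real b = of_int (n_thr \<xi> (Suc (Suc k))) - 1" using b(1) by linarith
    have la: "(real (Suc k))\<^sup>2 / \<xi>\<^sup>2 \<le> real a + 2" unfolding ra by (rule n_thr_lower)
    have lb: "real b < (real (Suc (Suc k)))\<^sup>2 / \<xi>\<^sup>2" unfolding rb by (rule n_thr_upper)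
    have "(real (Suc k))\<^sup>2 \<le> (real (Suc k))\<^sup>2 / \<xi>\<^sup>2"
      using square_diff_div_ge[of 0 "(real (Suc k))\<^sup>2"] by simp
    then have "real ((Suc k)\<^sup>2) \<le> real (a + 2)" using la by simp
    then have 1: "(k + 1)\<^sup>2 \<le> a + 2" unfolding of_nat_le_iff by simp
    \<comment> \<open>Cross-multiplication cancels \<open>\<xi>\<close>: the factor
      \<open>1 / \<xi>^2\<close> in the bound on \<open>b\<close> is absorbed by the lower bound on
      \<open>a + 2\<close>.\<close>
    have "real b * (real (Suc k))\<^sup>2 < (real (Suc (Suc k)))\<^sup>2 / \<xi>\<^sup>2 * (real (Suc k))\<^sup>2"
      using lb by (intro mult_strict_right_mono) auto
    also have "\<dots> = (real (Suc (Suc k)))\<^sup>2 * ((real (Suc k))\<^sup>2 / \<xi>\<^sup>2)" by simp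
    also have "\<dots> \<le> (real (Suc (Suc k)))\<^sup>2 * (real a + 2)"
      using la by (intro mult_left_mono) auto
    finally have "real (b * (Suc k)\<^sup>2) < real ((Suc (Suc k))\<^sup>2 * (a + 2))"
      by (simp only: of_nat_mult of_nat_power of_nat_add of_nat_numeral)
    then have 2: "b * (k + 1)\<^sup>2 < (k + 2)\<^sup>2 * (a + 2)" unfolding of_nat_less_iff by simp
    have "srw_central a k < srw_central b (k + 1)"
      using False 1 a(2) b(2) ab 2 by (intro srw_central_step_less) auto
    then show ?thesis unfolding a_def b_def by simp
  qed
qed

end

subsection \<open>Rademacher sums\<close>

lemma (in prob_space) indep_vars_reindex:
  assumes inj: "inj_on f I" and indep: "indep_vars (\<lambda>_. N) X (f ` I)"
  shows "indep_vars (\<lambda>_. N) (\<lambda>i. X (f i)) I"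
proof -
  define F where "F i = {X i -` A \<inter> space M | A. A \<in> sets N}" for i
  have rv: "random_variable N (X i)" if "i \<in> f ` I" for i
    using indep that unfolding indep_vars_def2 by blast
  have F: "indep_sets F (f ` I)"
    using indep unfolding F_def by (simp add: indep_vars_def2)
  have "indep_sets (\<lambda>i. F (f i)) I"
  proof (rule indep_setsI)
    show "F (f i) \<subseteq> events" if "i \<in> I" for i
      using rv[of "f i"] that by (auto simp: F_def measurable_sets)
    fix A J assume J: "J \<noteq> {}" "J \<subseteq> I" "finite J" "\<forall>j\<in>J. A j \<in> F (f j)"
    have inj': "inj_on f J" using inj J(2) by (rule inj_on_subset)
    define B where "B = A \<circ> the_inv_into J f"
    have B: "B (f j) = A j" if "j \<in> J" for j
      using that inj' by (simp add: B_def the_inv_into_f_f)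
    have "prob (\<Inter>i\<in>f ` J. B i) = (\<Prod>i\<in>f ` J. prob (B i))"
      using J B by (intro indep_setsD[OF F]) auto
    then show "prob (\<Inter>j\<in>J. A j) = (\<Prod>j\<in>J. prob (A j))"
      using B inj' by (simp add: prod.reindex)
  qed
  then show ?thesis
    using rv unfolding indep_vars_def2 F_def by auto
qed

locale rademacher_sequence = prob_space +
  fixes \<epsilon> :: "nat \<Rightarrow> 'a \<Rightarrow> real"
  assumes indep: "indep_vars (\<lambda>_. borel) \<epsilon> {1..}"
    and rademacher: "1 \<le> i \<Longrightarrow> rademacher M (\<epsilon> i)"
begin

lemma measurable_step [measurable]: "1 \<le> i \<Longrightarrow> \<epsilon> i \<in> borel_measurable M"
  using rademacher by (simp add: rademacher_def)

lemma measurable_walk [measurable]: "walk \<epsilon> n \<in> borel_measurable M"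
  unfolding walk_def[abs_def] by (intro borel_measurable_sum measurable_step) auto

lemma walk_0: "walk \<epsilon> 0 \<omega> = 0"
  by (simp add: walk_def)

lemma walk_Suc: "walk \<epsilon> (Suc n) \<omega> = walk \<epsilon> n \<omega> + \<epsilon> (Suc n) \<omega>"
  by (simp add: walk_def)

text \<open>The definition fixes only the probabilities of the two values, and these add up to 1.
  Hence the events below are compared almost everywhere.\<close>

lemma AE_step:
  assumes "1 \<le> i"
  shows "AE \<omega> in M. \<epsilon> i \<omega> = 1 \<or> \<epsilon> i \<omega> = -1"
proof -
  note [measurable] = measurable_step[OF assms]
  let ?A = "{\<omega> \<in> space M. \<epsilon> i \<omega> = 1}" and ?B = "{\<omega> \<in> space M. \<epsilon> i \<omega> = -1}"
  have "prob (?A \<union> ?B) = prob ?A + prob ?B"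
    by (intro finite_measure_Union) auto
  also have "\<dots> = 1" using rademacher[OF assms] by (simp add: rademacher_def)
  finally have "AE \<omega> in M. \<omega> \<in> ?A \<union> ?B" by (subst (asm) prob_eq_1) auto
  then show ?thesis by eventually_elim auto
qed

lemma AE_walk: "AE \<omega> in M. \<exists>s. walk \<epsilon> n \<omega> = of_int s \<and> even (int n + s)"
proof (induction n)
  case 0
  show ?case by (auto simp: walk_0 intro!: AE_I2 exI[of _ 0])
next
  case (Suc n)
  have "AE \<omega> in M. \<epsilon> (Suc n) \<omega> = 1 \<or> \<epsilon> (Suc n) \<omega> = -1" by (rule AE_step) simp
  with Suc show ?case
  proof eventually_elim
    case (elim \<omega>)
    then obtain s where s: "walk \<epsilon> n \<omega> = of_int s" "even (int n + s)" by blast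
    from elim(2) show ?case
    proof
      assume "\<epsilon> (Suc n) \<omega> = 1"
      then show ?case using s by (intro exI[of _ "s + 1"]) (auto simp: walk_Suc)
    next
      assume "\<epsilon> (Suc n) \<omega> = -1"
      then show ?case using s by (intro exI[of _ "s - 1"]) (auto simp: walk_Suc)
    qed
  qed
qed

lemma prob_step_and_walk:
  "prob {\<omega> \<in> space M. \<epsilon> (Suc n) \<omega> = x \<and> walk \<epsilon> n \<omega> = y} =
    prob {\<omega> \<in> space M. \<epsilon> (Suc n) \<omega> = x} * prob {\<omega> \<in> space M. walk \<epsilon> n \<omega> = y}"
proof -
  have "indep_vars (\<lambda>_. borel) \<epsilon> (insert (Suc n) {1..n})"
    using indep by (rule indep_vars_subset) auto
  then have "indep_var borel (\<epsilon> (Suc n)) borel (walk \<epsilon> n)"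
    unfolding walk_def[abs_def] by (intro indep_vars_sum) auto
  from indep_varD[OF this, of "{x}" "{y}"] show ?thesis
    by (simp add: vimage_def Int_def conj_commute)
qed

text \<open>Up to a null set the event splits by the last step, which is independent of the earlier
  walk; this reproduces the recursion of \<open>srw_pmf\<close>.\<close>

lemma prob_walk_eq: "prob {\<omega> \<in> space M. walk \<epsilon> n \<omega> = of_int i} = srw_pmf n i"
proof (induction n arbitrary: i)
  case 0
  show ?case by (auto simp: walk_0 prob_space)
next
  case (Suc n)
  note [measurable] = measurable_step[of "Suc n", simplified]
  define A where "A x y = {\<omega> \<in> space M. \<epsilon> (Suc n) \<omega> = x \<and> walk \<epsilon> n \<omega> = y}" for x y :: real
  have A [measurable]: "A x y \<in> events" for x y unfolding A_def by measurable
  have pA: "prob (A x (of_int s)) = srw_pmf n s / 2" if "x = 1 \<or> x = -1" for x s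
    using that rademacher[of "Suc n"] unfolding A_def prob_step_and_walk Suc
    by (auto simp: rademacher_def)
  have "prob {\<omega> \<in> space M. walk \<epsilon> (Suc n) \<omega> = of_int i} =
      prob (A 1 (of_int (i - 1)) \<union> A (-1) (of_int (i + 1)))"
  proof (rule finite_measure_eq_AE)
    have "AE \<omega> in M. \<epsilon> (Suc n) \<omega> = 1 \<or> \<epsilon> (Suc n) \<omega> = -1" by (rule AE_step) simp
    then show "AE \<omega> in M. \<omega> \<in> {\<omega> \<in> space M. walk \<epsilon> (Suc n) \<omega> = of_int i} \<longleftrightarrow>
        \<omega> \<in> A 1 (of_int (i - 1)) \<union> A (-1) (of_int (i + 1))"
      by eventually_elim (auto simp: A_def walk_Suc)
  qed auto
  also have "\<dots> = prob (A 1 (of_int (i - 1))) + prob (A (-1) (of_int (i + 1)))"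
    by (intro finite_measure_Union A) (auto simp: A_def)
  also have "\<dots> = srw_pmf (Suc n) i" 
    using pA[of 1 "i - 1"] pA[of "-1" "i + 1"] by (simp add: add_divide_distrib)
  finally show ?case .
qed

lemma prob_walk_le: "prob {\<omega> \<in> space M. \<bar>walk \<epsilon> n \<omega>\<bar> \<le> real k} = srw_central n k"
proof -
  define A where "A i = {\<omega> \<in> space M. walk \<epsilon> n \<omega> = of_int i}" for i :: int
  have A: "A i \<in> events" for i unfolding A_def by measurable
  have "prob {\<omega> \<in> space M. \<bar>walk \<epsilon> n \<omega>\<bar> \<le> real k} = prob (\<Union>i\<in>{- int k..int k}. A i)"
  proof (rule finite_measure_eq_AE)
    show "AE \<omega> in M. \<omega> \<in> {\<omega> \<in> space M. \<bar>walk \<epsilon> n \<omega>\<bar> \<le> real k} \<longleftrightarrow> \<omega> \<in> (\<Union>i\<in>{- int k..int k}. A i)"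
      using AE_walk[of n]
    proof eventually_elim
      case (elim \<omega>)
      then obtain s where s: "walk \<epsilon> n \<omega> = of_int s" by blast
      have "\<bar>of_int s\<bar> \<le> real k \<longleftrightarrow> s \<in> {- int k..int k}" by auto
      then show ?case using s by (auto simp: A_def)
    qed
  qed (use A in auto)
  also have "\<dots> = (\<Sum>i\<in>{- int k..int k}. prob (A i))"
    using A by (intro finite_measure_finite_Union) (auto simp: A_def disjoint_family_on_def)
  finally show ?thesis unfolding A_def prob_walk_eq srw_central_def .
qed

text \<open>Part (a): the events agree wherever the walk is an integer of the parity of
  \<open>n\<close>, hence almost surely.\<close>

lemma P_walk_C_set:
  assumes "0 < \<xi>" "\<xi> \<le> 1" "n \<in> C_set \<xi> k"
  shows "P_walk M \<epsilon> \<xi> n = prob {\<omega> \<in> space M. \<bar>walk \<epsilon> n \<omega>\<bar> \<le> real k}"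
  unfolding P_walk_def
proof (rule finite_measure_eq_AE)
  show "AE \<omega> in M. \<omega> \<in> {\<omega> \<in> space M. \<bar>walk \<epsilon> n \<omega>\<bar> \<le> \<xi> * sqrt (real n)} \<longleftrightarrow>
      \<omega> \<in> {\<omega> \<in> space M. \<bar>walk \<epsilon> n \<omega>\<bar> \<le> real k}"
    using AE_walk[of n] by eventually_elim (use abs_le_iff_C_set[OF assms] in auto)
qed auto

section \<open>The normal limit\<close>

text \<open>Supplies the common law for the central limit theorem: the two atoms give every Borel
  set a probability that does not depend on the index.\<close>

lemma distr_step:
  assumes "1 \<le> i" "1 \<le> j"
  shows "distr M borel (\<epsilon> i) = distr M borel (\<epsilon> j)"
proof (rule measure_eqI)
  fix A assume "A \<in> sets (distr M borel (\<epsilon> i))"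
  then have A [measurable]: "A \<in> sets borel" by simp
  have *: "emeasure (distr M borel (\<epsilon> i)) A = ennreal ((indicator A 1 + indicator A (-1)) / 2)"
    if i: "1 \<le> i" for i
  proof -
    note [measurable] = measurable_step[OF i]
    let ?A = "\<lambda>x. {\<omega> \<in> space M. \<epsilon> i \<omega> = x \<and> x \<in> A}"
    have pA: "prob (?A x) = indicator A x / 2" if "x = 1 \<or> x = -1" for x
      using rademacher[OF i] that by (cases "x \<in> A") (auto simp: rademacher_def)
    have "prob (\<epsilon> i -` A \<inter> space M) = prob (?A 1 \<union> ?A (-1))"
    proof (rule finite_measure_eq_AE)
      show "AE \<omega> in M. \<omega> \<in> \<epsilon> i -` A \<inter> space M \<longleftrightarrow> \<omega> \<in> ?A 1 \<union> ?A (-1)"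
        using AE_step[OF i] by eventually_elim auto
    qed auto
    also have "\<dots> = prob (?A 1) + prob (?A (-1))" by (intro finite_measure_Union) auto
    finally show ?thesis
      by (simp add: emeasure_distr emeasure_eq_measure pA add_divide_distrib)
  qed
  show "emeasure (distr M borel (\<epsilon> i)) A = emeasure (distr M borel (\<epsilon> j)) A"
    unfolding *[OF assms(1)] *[OF assms(2)] ..
qed simp

lemma expectation_step:
  assumes i: "1 \<le> i"
  shows "expectation (\<epsilon> i) = 0"
proof -
  note [measurable] = measurable_step[OF i]
  let ?A = "{\<omega> \<in> space M. \<epsilon> i \<omega> = 1}" and ?B = "{\<omega> \<in> space M. \<epsilon> i \<omega> = -1}"
  have "expectation (\<epsilon> i) = expectation (\<lambda>\<omega>. indicator ?A \<omega> - indicator ?B \<omega>)"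
  proof (rule integral_cong_AE)
    show "AE \<omega> in M. \<epsilon> i \<omega> = indicator ?A \<omega> - indicator ?B \<omega>"
      using AE_step[OF i] AE_space by eventually_elim auto
  qed auto
  also have "\<dots> = prob ?A - prob ?B"
    by (subst Bochner_Integration.integral_diff) (auto simp: Int_absorb1 subset_eq simp: less_top[symmetric] intro!: integrable_real_indicator)
  finally show ?thesis using rademacher[OF i] by (simp add: rademacher_def)
qed

lemma weak_conv_walk:
  "weak_conv_m (\<lambda>n. distr M borel (\<lambda>\<omega>. walk \<epsilon> n \<omega> / sqrt (real n))) std_normal_distribution"
proof -
  \<comment> \<open>The central limit theorem indexes from 0, hence the shift.\<close>
  let ?X = "\<lambda>i. \<epsilon> (Suc i)"
  have sq: "AE \<omega> in M. (?X n \<omega>)\<^sup>2 = 1" for n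
    using AE_step[of "Suc n"] by (auto elim: eventually_mono)
  have "weak_conv_m (\<lambda>n. distr M borel (\<lambda>\<omega>. (\<Sum>i<n. ?X i \<omega>) / sqrt (real n * 1\<^sup>2))) std_normal_distribution"
  proof (rule central_limit_theorem_zero_mean)
    show "indep_vars (\<lambda>_. borel) ?X UNIV"
      using indep_vars_subset[OF indep, of "range Suc"]
      by (intro indep_vars_reindex[where f = Suc]) auto
    show "expectation (?X n) = 0" for n by (simp add: expectation_step)
    show "integrable M (\<lambda>x. (?X n x)\<^sup>2)" for n
      using sq[of n] by (intro integrable_const_bound[where B = 1]) (auto elim: eventually_mono)
    have "expectation (\<lambda>x. (?X n x)\<^sup>2) = expectation (\<lambda>_. 1)" for n
      using sq by (intro integral_cong_AE) auto
    then show "variance (?X n) = 1\<^sup>2" for n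
      by (simp add: expectation_step prob_space)
    show "distr M borel (?X n) = distr M borel (\<epsilon> 1)" for n by (rule distr_step) auto
  qed simp
  moreover have "(\<Sum>i<n. ?X i \<omega>) = walk \<epsilon> n \<omega>" for n \<omega>
    unfolding walk_def by (rule sum.reindex_bij_witness[of _ "\<lambda>i. i - 1" Suc]) auto
  ultimately show ?thesis by simp
qed

end

context rademacher_sequence
begin

text \<open>The interval is a continuity set of the normal law, since its frontier has at most two
  points.\<close>

lemma P_walk_tendsto:
  "P_walk M \<epsilon> \<xi> \<longlonglongrightarrow> measure std_normal_distribution {- \<xi>..\<xi>}"
proof -
  let ?D = "\<lambda>n. distr M borel (\<lambda>\<omega>. walk \<epsilon> n \<omega> / sqrt (real n))"
  have "(\<lambda>n. measure (?D n) {- \<xi>..\<xi>}) \<longlonglongrightarrow> measure std_normal_distribution {- \<xi>..\<xi>}"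
  proof (rule weak_conv_imp_continuity_set_conv)
    show "real_distribution (?D n)" for n by (rule real_distribution_distr) measurable
    show "emeasure std_normal_distribution (frontier {- \<xi>..\<xi>}) = 0"
    proof -
      have "frontier {- \<xi>..\<xi>} \<subseteq> {- \<xi>, \<xi>}" by (auto simp: frontier_def)
      then have "finite (frontier {- \<xi>..\<xi>})" by (rule finite_subset) simp
      then have null: "frontier {- \<xi>..\<xi>} \<in> null_sets lborel" by (rule finite_imp_null_set_lborel)
      then have "frontier {- \<xi>..\<xi>} \<in> null_sets std_normal_distribution"
        using AE_not_in[OF null] by (subst null_sets_density_iff) (auto elim: eventually_mono)
      then show ?thesis by auto
    qed
  qed (auto intro: real_dist_normal_dist weak_conv_walk)
  \<comment> \<open>Clearing the denominator \<open>sqrt n\<close> requires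
    \<open>n > 0\<close>.\<close>
  moreover have "\<forall>\<^sub>F n in sequentially. measure (?D n) {- \<xi>..\<xi>} = P_walk M \<epsilon> \<xi> n"
    using eventually_gt_at_top[of 0]
  proof eventually_elim
    case (elim n)
    then have "(\<lambda>\<omega>. walk \<epsilon> n \<omega> / sqrt (real n)) -` {- \<xi>..\<xi>} \<inter> space M =
        {\<omega> \<in> space M. \<bar>walk \<epsilon> n \<omega>\<bar> \<le> \<xi> * sqrt (real n)}"
      by (auto simp: abs_le_iff pos_le_divide_eq pos_divide_le_eq)
    then show ?case unfolding P_walk_def by (subst measure_distr) auto
  qed
  ultimately show ?thesis by (rule Lim_transform_eventually)
qed

end

text \<open>Reflection preserves Lebesgue measure and the density, so the two tails agree; removing
  both from total mass 1 leaves the interval.\<close>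

lemma measure_std_normal_symmetric_interval:
  assumes "0 \<le> x"
  shows "measure std_normal_distribution {- x..x} = 2 * cdf std_normal_distribution x - 1"
proof -
  interpret D: real_distribution std_normal_distribution by (rule real_dist_normal_dist)
  let ?P = "measure std_normal_distribution"
  have "emeasure std_normal_distribution {..<- x} = emeasure (density (distr lborel borel uminus) std_normal_density) {..<- x}"
    by (simp add: lborel_distr_uminus)
  also have "\<dots> = emeasure std_normal_distribution {x<..}"
    by (simp add: emeasure_density nn_integral_distr normal_density_def)
      (auto intro!: nn_integral_cong split: split_indicator)
  finally have sym: "?P {..<- x} = ?P {x<..}" by (simp add: measure_def)
  have "?P ({..<- x} \<union> {- x..x}) = ?P {..<- x} + ?P {- x..x}"
    by (intro D.finite_measure_Union) auto
  moreover have "{..<- x} \<union> {- x..x} = {..x}" using assms by auto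
  ultimately have 1: "?P {..x} = ?P {..<- x} + ?P {- x..x}" by simp
  have "?P ({..x} \<union> {x<..}) = ?P {..x} + ?P {x<..}"
    by (intro D.finite_measure_Union) auto
  moreover have "{..x} \<union> {x<..} = UNIV" by auto
  ultimately have "?P {..x} + ?P {x<..} = 1" using D.prob_space by simp
  with 1 sym show ?thesis by (simp add: cdf_def)
qed

theorem theorem1:
  fixes M :: "'a measure" and \<epsilon> :: "nat \<Rightarrow> 'a \<Rightarrow> real" and \<xi> :: real
  assumes "prob_space M"
    and "prob_space.indep_vars M (\<lambda>_. borel) \<epsilon> {1..}"
    and "\<And>i. 1 \<le> i \<Longrightarrow> rademacher M (\<epsilon> i)"
    and "0 < \<xi>" and "\<xi> \<le> 1"
  shows "(\<forall>k. \<forall>n\<in>C_set \<xi> k.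
            P_walk M \<epsilon> \<xi> n = measure M {\<omega> \<in> space M. \<bar>walk \<epsilon> n \<omega>\<bar> \<le> real k}) \<and>
         (\<forall>k. \<xi> < 1 \<or> 1 \<le> k \<longrightarrow>
            finite (C_set \<xi> k) \<and> C_set \<xi> k \<noteq> {} \<and>
            Q_minus M \<epsilon> \<xi> k = Min (P_walk M \<epsilon> \<xi> ` C_set \<xi> k)) \<and>
         strict_mono_on {k. \<xi> < 1 \<or> 1 \<le> k} (Q_minus M \<epsilon> \<xi>) \<and>
         Q_minus M \<epsilon> \<xi> \<longlonglongrightarrow> 2 * cdf std_normal_distribution \<xi> - 1 \<and>
         Q_minus M \<epsilon> \<xi> 1 = P_walk M \<epsilon> \<xi> (nat (n_thr \<xi> 2 - 1)) \<and>
         (\<forall>n. n_thr \<xi> 1 \<le> int n \<longrightarrow> Q_minus M \<epsilon> \<xi> 1 \<le> P_walk M \<epsilon> \<xi> n)"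
proof -
  interpret prob_space M by fact
  interpret rademacher_sequence M \<epsilon> by unfold_locales fact+
  note \<xi> = \<open>0 < \<xi>\<close> \<open>\<xi> \<le> 1\<close>
  have central: "P_walk M \<epsilon> \<xi> n = srw_central n k" if "n \<in> C_set \<xi> k" for n k
    using P_walk_C_set[OF \<xi> that] by (simp add: prob_walk_le)
  have Q: "Q_minus M \<epsilon> \<xi> k = srw_central (nat (n_thr \<xi> (Suc k) - 1)) k" if "\<xi> < 1 \<or> 1 \<le> k" for k
    unfolding Q_minus_def using C_set_last(2)[OF \<xi> that] by (rule central)
  have Q_le: "Q_minus M \<epsilon> \<xi> k \<le> P_walk M \<epsilon> \<xi> n" if k: "\<xi> < 1 \<or> 1 \<le> k" and n: "n \<in> C_set \<xi> k" for n k
  proof -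
    have "int n \<le> int (nat (n_thr \<xi> (Suc k) - 1))"
      unfolding C_set_last(1)[OF \<xi> k] using n by (simp add: C_set_def)
    then have "n \<le> nat (n_thr \<xi> (Suc k) - 1)" by (simp only: of_nat_le_iff)
    with C_set_last(3)[OF \<xi> k] show ?thesis
      unfolding Q[OF k] central[OF n] by (rule srw_central_antimono)
  qed
  have Q_less: "Q_minus M \<epsilon> \<xi> k < Q_minus M \<epsilon> \<xi> (Suc k)" if k: "\<xi> < 1 \<or> 1 \<le> k" for k
    using srw_central_last_less[OF \<xi> k] Q[OF k] Q[of "Suc k"] by simp
  have mono: "Q_minus M \<epsilon> \<xi> k < Q_minus M \<epsilon> \<xi> l" if "\<xi> < 1 \<or> 1 \<le> k" "k < l" for k l
    using that(2)
  proof (induction l)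
    case (Suc l)
    have "Q_minus M \<epsilon> \<xi> l < Q_minus M \<epsilon> \<xi> (Suc l)" using that(1) Suc.prems by (intro Q_less) auto
    then show ?case using Suc by (cases "k = l") auto
  qed simp
  have "Q_minus M \<epsilon> \<xi> k = Min (P_walk M \<epsilon> \<xi> ` C_set \<xi> k)" if k: "\<xi> < 1 \<or> 1 \<le> k" for k
    using Q_le[OF k] C_set_last(2)[OF \<xi> k]
    by (intro Min_eqI[symmetric]) (auto simp: finite_C_set[OF \<xi>] Q_minus_def)
  moreover have "C_set \<xi> k \<noteq> {}" if "\<xi> < 1 \<or> 1 \<le> k" for k
    using C_set_last(2)[OF \<xi> that] by auto
  moreover have "strict_mono_on {k. \<xi> < 1 \<or> 1 \<le> k} (Q_minus M \<epsilon> \<xi>)"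
    by (rule strict_mono_onI) (use mono in auto)
  moreover have "Q_minus M \<epsilon> \<xi> \<longlonglongrightarrow> 2 * cdf std_normal_distribution \<xi> - 1"
  proof -
    \<comment> \<open>\<open>Q_minus\<close> samples \<open>P_walk\<close> at the last elements of
      the blocks; these diverge because \<open>n_thr_ge\<close> gives
      \<open>k \<le> n_thr \<xi> (Suc k)\<close>.\<close>
    have "filterlim (\<lambda>k. nat (n_thr \<xi> (Suc k) - 1)) sequentially sequentially"
    proof (rule filterlim_at_top_mono[where f = "\<lambda>k. k - 1"])
      show "filterlim (\<lambda>k. k - 1) sequentially sequentially" by (rule filterlim_minus_const_nat_at_top)
      show "\<forall>\<^sub>F k in sequentially. k - 1 \<le> nat (n_thr \<xi> (Suc k) - 1)"
        
      proof (intro always_eventually allI)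
        show "k - 1 \<le> nat (n_thr \<xi> (Suc k) - 1)" for k using n_thr_ge[OF \<xi>, of "Suc k"] by linarith
      qed
    qed
    then have "(\<lambda>k. P_walk M \<epsilon> \<xi> (nat (n_thr \<xi> (Suc k) - 1))) \<longlonglongrightarrow> measure std_normal_distribution {- \<xi>..\<xi>}"
      by (rule filterlim_compose[OF P_walk_tendsto])
    then show ?thesis
      using \<xi> by (simp add: Q_minus_def[abs_def] measure_std_normal_symmetric_interval)
  qed
  moreover have "Q_minus M \<epsilon> \<xi> 1 \<le> P_walk M \<epsilon> \<xi> n" if n: "n_thr \<xi> 1 \<le> int n" for n
  proof -
    \<comment> \<open>Part (e) combines (b) on the block of \<open>n\<close> with the monotonicity
      (c) from index 1 on.\<close>
    obtain k where k: "1 \<le> k" "n \<in> C_set \<xi> k" using C_set_cover[OF \<xi> n] .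
    have "Q_minus M \<epsilon> \<xi> 1 \<le> Q_minus M \<epsilon> \<xi> k"
      using mono[of 1 k] k(1) by (cases "k = 1") auto
    also have "\<dots> \<le> P_walk M \<epsilon> \<xi> n" using k by (intro Q_le) auto
    finally show ?thesis .
  qed
  moreover have "Q_minus M \<epsilon> \<xi> 1 = P_walk M \<epsilon> \<xi> (nat (n_thr \<xi> 2 - 1))"
    by (simp add: Q_minus_def numeral_2_eq_2)
  ultimately show ?thesis
    using P_walk_C_set[OF \<xi>] finite_C_set[OF \<xi>] by blast
qed

end
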